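(* Let $\Omega$ be a bounded domain in $\mathbb{C}^n$, $p\in\Omega$, and $\{\phi_j\}\subset\mathrm{Aut}(\Omega)$ a sequence such that $\{\phi_j(p)\}$ converges to some point of $\partial\Omega$. Assume that there is a sequence $\{\psi_j\}\subset\mathrm{Aut}(\mathbb{C}^n)$ satisfying: (1) $\{\psi_j\}$ converges to some $\widehat\psi\in\mathrm{Aut}(\mathbb{C}^n)$ uniformly on compact subsets of $\mathbb{C}^n$. (2) There is a sequence $\{D_j\}$ of $\mathbb{C}$-affine maps such that the sequence $\{D_j\circ\psi_j\circ\phi_j\}$ converges, uniformly on compact subsets of $\Omega$, to a biholomorphism of $\Omega$ into $\mathbb{C}^n$ (that is, onto its image). Then the modified Frankel scaling sequence $\{\omega_j\}$ by $\{\psi_j\}$ has a subsequence that converges to a biholomorphism into $\mathbb{C}^n$ uniformly on compact subsets of $\widehat\psi(\Omega)$.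
   Context: $\mathrm{Aut}(M)$ denotes the group of biholomorphic self-maps of $M$. Given $\Omega$, $p$, $\{\phi_j\}$ and a sequence $\{\psi_j\}\subset\mathrm{Aut}(\mathbb{C}^n)$ converging uniformly on compact sets to an automorphism $\widehat\psi$ of $\mathbb{C}^n$, the modified Frankel scaling sequence by $\{\psi_j\}$ is the sequence of maps $\omega_j:\psi_j(\Omega)\to\mathbb{C}^n$, $$\omega_j(\mathbf z) := [d(\psi_j\circ\phi_j\circ\psi_j^{-1})|_{\psi_j(p)}]^{-1}\big(\psi_j\circ\phi_j\circ\psi_j^{-1}(\mathbf z)-\psi_j\circ\phi_j(p)\big).$$ Every compact subset of $\widehat\psi(\Omega)$ is contained in $\psi_j(\Omega)$ for all large $j$, so convergence on compact subsets of $\widehat\psi(\Omega)$ makes sense. *)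

theory Defs
  imports "HOL-Analysis.Analysis"
begin

text \<open>Complex linearity is linearity for the scalar action \<open>(*s)\<close> of \<open>complex\<close> on \<open>complex ^ 'n\<close>;
  \<open>has_derivative\<close> by itself only provides real linearity.\<close>

definition holomorphic_map_on ::
    "(complex ^ 'n \<Rightarrow> complex ^ 'm) \<Rightarrow> (complex ^ 'n) set \<Rightarrow> bool" where
  "holomorphic_map_on f U \<longleftrightarrow>
     (\<forall>z\<in>U. \<exists>f'. (f has_derivative f') (at z) \<and> Vector_Spaces.linear (*s) (*s) f')"

definition biholomorphism ::
    "(complex ^ 'n \<Rightarrow> complex ^ 'n) \<Rightarrow> (complex ^ 'n) set \<Rightarrow> (complex ^ 'n) set \<Rightarrow> bool" where
  "biholomorphism f U V \<longleftrightarrow>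
     open U \<and> open V \<and> bij_betw f U V \<and>
     holomorphic_map_on f U \<and> holomorphic_map_on (inv_into U f) V"

definition biholomorphism_into ::
    "(complex ^ 'n \<Rightarrow> complex ^ 'n) \<Rightarrow> (complex ^ 'n) set \<Rightarrow> bool" where
  "biholomorphism_into f U \<longleftrightarrow> biholomorphism f U (f ` U)"

text \<open>Maps are total functions; only their values on \<open>U\<close> are meaningful.\<close>

definition Aut :: "(complex ^ 'n) set \<Rightarrow> (complex ^ 'n \<Rightarrow> complex ^ 'n) set" where
  "Aut U = {f. biholomorphism f U U}"

definition complex_affine :: "(complex ^ 'n \<Rightarrow> complex ^ 'm) \<Rightarrow> bool" where
  "complex_affine D \<longleftrightarrow> (\<exists>A b. \<forall>z. D z = A *v z + b)"

text \<open>Uniform convergence on compact subsets of \<open>U\<close> of maps \<open>f j\<close> whose domains \<open>V j\<close> may vary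
  with \<open>j\<close>: each compact subset of \<open>U\<close> has to lie in \<open>V j\<close> for all large \<open>j\<close>.\<close>

definition compact_convergence ::
    "(nat \<Rightarrow> 'a::topological_space set) \<Rightarrow> (nat \<Rightarrow> 'a \<Rightarrow> 'b::metric_space) \<Rightarrow>
     'a set \<Rightarrow> ('a \<Rightarrow> 'b) \<Rightarrow> bool" where
  "compact_convergence V f U g \<longleftrightarrow>
     (\<forall>K. compact K \<and> K \<subseteq> U \<longrightarrow>
        (\<forall>\<^sub>F j in sequentially. K \<subseteq> V j) \<and> uniform_limit K f g sequentially)"

text \<open>For \<open>\<psi>\<close> in \<open>Aut UNIV\<close> and \<open>\<phi>\<close> in \<open>Aut \<Omega>\<close>, this is a map on \<open>\<psi> ` \<Omega>\<close>.\<close>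

definition frankel_scaling ::
    "(complex ^ 'n \<Rightarrow> complex ^ 'n) \<Rightarrow> (complex ^ 'n \<Rightarrow> complex ^ 'n) \<Rightarrow> complex ^ 'n \<Rightarrow>
     complex ^ 'n \<Rightarrow> complex ^ 'n" where
  "frankel_scaling \<psi> \<phi> p z =
     inv (frechet_derivative (\<psi> \<circ> \<phi> \<circ> inv \<psi>) (at (\<psi> p)))
       ((\<psi> \<circ> \<phi> \<circ> inv \<psi>) z - (\<psi> \<circ> \<phi>) p)"

end

theory Submission
  imports Defs "HOL-Complex_Analysis.Cauchy_Integral_Formula"
begin

text \<open>
  The scaled maps differ from \<open>h\<^sub>j = D\<^sub>j \<circ> \<psi>\<^sub>j \<circ> \<phi>\<^sub>j\<close>, whose convergence is given, only by affine
  normalisation and a change of coordinates. Write \<open>G\<^sub>j = \<psi>\<^sub>j \<circ> \<phi>\<^sub>j \<circ> \<psi>\<^sub>j\<inverse>\<close> and let \<open>L\<^sub>j\<close> be its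
  derivative at \<open>\<psi>\<^sub>j(p)\<close>, so that \<open>v = \<omega>\<^sub>j(z)\<close> solves \<open>L\<^sub>j v = G\<^sub>j(z) - G\<^sub>j(\<psi>\<^sub>j(p))\<close>. Applying the linear
  part \<open>A\<^sub>j\<close> of \<open>D\<^sub>j\<close> gives \<open>A\<^sub>j L\<^sub>j v = h\<^sub>j(\<psi>\<^sub>j\<inverse>(z)) - h\<^sub>j(p)\<close>. By the chain rule
  \<open>A\<^sub>j L\<^sub>j P\<^sub>j = B\<^sub>j\<close>, where \<open>P\<^sub>j\<close> and \<open>B\<^sub>j\<close> are the derivatives of \<open>\<psi>\<^sub>j\<close> and \<open>h\<^sub>j\<close> at \<open>p\<close>. Hence
  \<open>\<omega>\<^sub>j(z) = P\<^sub>j w\<close> where \<open>w\<close> solves \<open>B\<^sub>j w = h\<^sub>j(\<psi>\<^sub>j\<inverse>(z)) - h\<^sub>j(p)\<close>: the maps \<open>\<phi>\<^sub>j\<close> and \<open>D\<^sub>j\<close>,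
  which may degenerate, now enter through \<open>h\<^sub>j\<close> only.

  Each ingredient converges. \<open>P\<^sub>j\<close> and \<open>B\<^sub>j\<close> converge to the derivatives of \<open>\<psi>hat\<close> and \<open>h\<close> by Cauchy's
  estimates on complex lines (\<open>holomorphic_derivative_tendsto\<close>). The inverses \<open>\<psi>\<^sub>j\<inverse>\<close> converge
  locally uniformly to \<open>\<psi>hat\<inverse>\<close> by a fixed point argument
  (\<open>uniform_limit_inverse_homeomorphisms\<close>), so the right-hand sides converge uniformly on compact
  sets (\<open>uniform_limit_compose_locally\<close>). As the derivative of \<open>h\<close> at \<open>p\<close> is invertible, the solutions
  converge as well (\<open>uniform_limit_linear_solve\<close>). The limit is the map
  \<open>z \<mapsto> d\<psi>hat(p) (dh(p)\<inverse> (h(\<psi>hat\<inverse>(z)) - h(p)))\<close>, a composition of biholomorphisms, and the whole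
  sequence converges to it.
\<close>

section \<open>Holomorphic and biholomorphic maps of several variables\<close>

lemma scaleR_vec_conv_of_real: "r *\<^sub>R x = complex_of_real r *s x" for x :: "complex ^ 'n"
  unfolding vec_eq_iff by (simp only: vector_scaleR_component vector_smult_component scaleR_conv_of_real[where 'a = complex] simp_thms)

lemma complex_linear_imp_linear:
  fixes T :: "complex ^ 'n \<Rightarrow> complex ^ 'm"
  assumes "Vector_Spaces.linear (*s) (*s) T"
  shows "linear T"
proof -
  interpret T: Vector_Spaces.linear "(*s)" "(*s)" T by fact
  show ?thesis
    by (rule linearI) (simp_all only: T.add T.scale scaleR_vec_conv_of_real)
qed

lemma holomorphic_map_on_subset:
  "holomorphic_map_on f V \<Longrightarrow> U \<subseteq> V \<Longrightarrow> holomorphic_map_on f U"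
  by (auto simp: holomorphic_map_on_def)

lemma holomorphic_map_on_compose:
  assumes "holomorphic_map_on f U" "holomorphic_map_on g V" "f ` U \<subseteq> V"
  shows "holomorphic_map_on (g \<circ> f) U"
  unfolding holomorphic_map_on_def
proof
  fix z assume z: "z \<in> U"
  obtain f' where f': "(f has_derivative f') (at z)" "Vector_Spaces.linear (*s) (*s) f'"
    using assms(1) z by (auto simp: holomorphic_map_on_def)
  obtain g' where g': "(g has_derivative g') (at (f z))" "Vector_Spaces.linear (*s) (*s) g'"
    using assms(2,3) z by (auto simp: holomorphic_map_on_def)
  show "\<exists>d. (g \<circ> f has_derivative d) (at z) \<and> Vector_Spaces.linear (*s) (*s) d"
    using diff_chain_at[OF f'(1) g'(1)] Vector_Spaces.linear_compose[OF f'(2) g'(2)] by blast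
qed

lemma holomorphic_map_on_transform:
  assumes "holomorphic_map_on f U" "open U" "\<And>z. z \<in> U \<Longrightarrow> f z = g z"
  shows "holomorphic_map_on g U"
  unfolding holomorphic_map_on_def
proof
  fix z assume z: "z \<in> U"
  obtain f' where f': "(f has_derivative f') (at z)" "Vector_Spaces.linear (*s) (*s) f'"
    using assms(1) z by (auto simp: holomorphic_map_on_def)
  have "(g has_derivative f') (at z)"
    by (rule has_derivative_transform_within_open[OF f'(1) assms(2) z assms(3)])
  with f'(2) show "\<exists>d. (g has_derivative d) (at z) \<and> Vector_Spaces.linear (*s) (*s) d"
    by blast
qed

lemma holomorphic_map_on_imp_continuous_on:
  "holomorphic_map_on f U \<Longrightarrow> continuous_on U f"
  unfolding holomorphic_map_on_def
  by (meson continuous_at_imp_continuous_on has_derivative_continuous)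

lemma complex_linear_imp_holomorphic_map_on:
  assumes "Vector_Spaces.linear (*s) (*s) T"
  shows "holomorphic_map_on (\<lambda>z. T (z - a) + b) U"
proof -
  have "bounded_linear T"
    using complex_linear_imp_linear[OF assms] linear_conv_bounded_linear by blast
  then have "((\<lambda>z. T (z - a)) has_derivative T) (at z)" for z
    by (rule bounded_linear.has_derivative[where g = "\<lambda>z. z - a" and g' = "\<lambda>z. z", simplified])
       (auto intro!: derivative_eq_intros)
  then have "((\<lambda>z. T (z - a) + b) has_derivative T) (at z)" for z
    using has_derivative_add[OF _ has_derivative_const] by fastforce
  with assms show ?thesis by (auto simp: holomorphic_map_on_def)
qed

text \<open>Composition, inversion and restriction are easier for an arbitrary two-sided inverse than for
  \<open>inv_into\<close>, which depends on the chosen domain.\<close>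

lemma biholomorphism_iff:
  "biholomorphism f U V \<longleftrightarrow> open U \<and> open V \<and>
     (\<exists>g. holomorphic_map_on f U \<and> holomorphic_map_on g V \<and> f ` U \<subseteq> V \<and> g ` V \<subseteq> U \<and>
          (\<forall>z\<in>U. g (f z) = z) \<and> (\<forall>w\<in>V. f (g w) = w))"
proof
  assume b: "biholomorphism f U V"
  then have "inj_on f U" "f ` U = V" by (auto simp: biholomorphism_def bij_betw_def)
  with b show "open U \<and> open V \<and>
     (\<exists>g. holomorphic_map_on f U \<and> holomorphic_map_on g V \<and> f ` U \<subseteq> V \<and> g ` V \<subseteq> U \<and>
          (\<forall>z\<in>U. g (f z) = z) \<and> (\<forall>w\<in>V. f (g w) = w))"
    by (intro conjI exI[of _ "inv_into U f"])
       (auto simp: biholomorphism_def inv_into_into f_inv_into_f)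
next
  assume "open U \<and> open V \<and>
     (\<exists>g. holomorphic_map_on f U \<and> holomorphic_map_on g V \<and> f ` U \<subseteq> V \<and> g ` V \<subseteq> U \<and>
          (\<forall>z\<in>U. g (f z) = z) \<and> (\<forall>w\<in>V. f (g w) = w))"
  then obtain g where o: "open U" "open V" and h: "holomorphic_map_on f U" "holomorphic_map_on g V"
    and m: "f ` U \<subseteq> V" "g ` V \<subseteq> U" and i: "\<And>z. z \<in> U \<Longrightarrow> g (f z) = z"
      "\<And>w. w \<in> V \<Longrightarrow> f (g w) = w"
    by blast
  have b: "bij_betw f U V"
    using m i by (intro bij_betw_byWitness[where f' = g]) auto
  have "g w = inv_into U f w" if "w \<in> V" for w
    using that i m b by (metis bij_betw_imp_inj_on image_subset_iff inv_into_f_f)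
  then have "holomorphic_map_on (inv_into U f) V"
    by (rule holomorphic_map_on_transform[OF h(2) o(2)])
  with o h b show "biholomorphism f U V" by (simp add: biholomorphism_def)
qed

lemma biholomorphism_compose:
  assumes "biholomorphism f U V" "biholomorphism g V W"
  shows "biholomorphism (g \<circ> f) U W"
proof -
  obtain f' where o: "open U" and f: "holomorphic_map_on f U" "holomorphic_map_on f' V"
    "f ` U \<subseteq> V" "f' ` V \<subseteq> U" "\<forall>z\<in>U. f' (f z) = z" "\<forall>w\<in>V. f (f' w) = w"
    using assms(1) unfolding biholomorphism_iff by blast
  obtain g' where o': "open W" and g: "holomorphic_map_on g V" "holomorphic_map_on g' W"
    "g ` V \<subseteq> W" "g' ` W \<subseteq> V" "\<forall>z\<in>V. g' (g z) = z" "\<forall>w\<in>W. g (g' w) = w"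
    using assms(2) unfolding biholomorphism_iff by blast
  show ?thesis
    unfolding biholomorphism_iff
    using o o' f g
    by (intro conjI exI[of _ "f' \<circ> g'"] holomorphic_map_on_compose[where V = V])
       (auto simp: image_subset_iff)
qed

lemma biholomorphism_inv_into:
  assumes "biholomorphism f U V"
  shows "biholomorphism (inv_into U f) V U"
  unfolding biholomorphism_iff
  using assms
  by (intro conjI exI[of _ f])
     (auto simp: biholomorphism_def bij_betw_def inv_into_into f_inv_into_f)

lemma biholomorphism_restrict:
  assumes "biholomorphism f U V" "open U'" "U' \<subseteq> U"
  shows "biholomorphism f U' (f ` U')"
proof -
  obtain g where o: "open V" and f: "holomorphic_map_on f U" and g: "holomorphic_map_on g V"
    and m: "f ` U \<subseteq> V" "g ` V \<subseteq> U" and i: "\<forall>z\<in>U. g (f z) = z" "\<forall>w\<in>V. f (g w) = w"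
    using assms(1) unfolding biholomorphism_iff by blast
  have "f ` U' = V \<inter> g -` U'" using m i assms(3) by force
  moreover have "open (V \<inter> g -` U')"
    using continuous_on_open_vimage[OF o] holomorphic_map_on_imp_continuous_on[OF g] assms(2)
    by (metis Int_commute)
  ultimately have "open (f ` U')" by simp
  moreover have fU: "f ` U' \<subseteq> V" using m(1) image_mono[OF assms(3)] by (rule order_trans[rotated])
  ultimately show ?thesis
    unfolding biholomorphism_iff
    using holomorphic_map_on_subset[OF f assms(3)] holomorphic_map_on_subset[OF g fU]
      i m assms(2,3)
    by (intro conjI exI[of _ g]) auto
qed

text \<open>By the chain rule, the derivatives of the map and of its inverse are inverse to each other.\<close>

lemma biholomorphism_derivative:
  fixes f :: "complex ^ 'n \<Rightarrow> complex ^ 'n"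
  assumes "biholomorphism f U V" "z \<in> U"
  obtains f' g' where "(f has_derivative f') (at z)"
    "Vector_Spaces.linear (*s) (*s) f'" "Vector_Spaces.linear (*s) (*s) g'"
    "\<And>v. g' (f' v) = v" "\<And>v. f' (g' v) = v"
proof -
  obtain g where o: "open U" "open V" and f: "holomorphic_map_on f U" and g: "holomorphic_map_on g V"
    and m: "f ` U \<subseteq> V" "g ` V \<subseteq> U" and i: "\<And>z. z \<in> U \<Longrightarrow> g (f z) = z" "\<And>w. w \<in> V \<Longrightarrow> f (g w) = w"
    using assms(1) unfolding biholomorphism_iff by blast
  have fz: "f z \<in> V" using m assms(2) by auto
  obtain f' where f': "(f has_derivative f') (at z)" "Vector_Spaces.linear (*s) (*s) f'"
    using f assms(2) by (auto simp: holomorphic_map_on_def)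
  obtain g' where g': "(g has_derivative g') (at (f z))" "Vector_Spaces.linear (*s) (*s) g'"
    using g fz by (auto simp: holomorphic_map_on_def)
  have "(g \<circ> f has_derivative g' \<circ> f') (at z)"
    by (rule diff_chain_at[OF f'(1) g'(1)])
  then have "(id has_derivative g' \<circ> f') (at z)"
    by (rule has_derivative_transform_within_open[OF _ o(1) assms(2)]) (simp add: i)
  then have 1: "g' \<circ> f' = id"
    using has_derivative_unique has_derivative_id by (metis eq_id_iff)
  have "(f \<circ> g has_derivative f' \<circ> g') (at (f z))"
    by (rule diff_chain_at[OF g'(1)]) (simp add: i assms(2) f'(1))
  then have "(id has_derivative f' \<circ> g') (at (f z))"
    by (rule has_derivative_transform_within_open[OF _ o(2) fz]) (simp add: i)
  then have 2: "f' \<circ> g' = id"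
    using has_derivative_unique has_derivative_id by (metis eq_id_iff)
  show ?thesis
    using that[OF f' g'(2)] 1 2 by (simp add: fun_eq_iff)
qed

lemma biholomorphism_complex_affine:
  fixes T :: "complex ^ 'n \<Rightarrow> complex ^ 'n"
  assumes "Vector_Spaces.linear (*s) (*s) T" "Vector_Spaces.linear (*s) (*s) S"
    "\<And>v. S (T v) = v" "\<And>v. T (S v) = v"
  shows "biholomorphism (\<lambda>z. T (z - a)) UNIV UNIV"
proof -
  have "holomorphic_map_on (\<lambda>z. T (z - a)) UNIV" "holomorphic_map_on (\<lambda>z. S z + a) UNIV"
    using complex_linear_imp_holomorphic_map_on[OF assms(1), of a 0]
      complex_linear_imp_holomorphic_map_on[OF assms(2), of 0 a] by simp_all
  then show ?thesis
    unfolding biholomorphism_iff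
    by (intro conjI exI[of _ "\<lambda>z. S z + a"]) (simp_all add: assms(3,4))
qed

section \<open>Convergence of derivatives\<close>

text \<open>On the complex line through \<open>p\<close> in direction \<open>v\<close>, each component is a holomorphic function of
  one variable whose derivative at \<open>0\<close> is the component of the directional derivative, because the
  derivatives are complex linear. The one-variable theorem on uniform limits of holomorphic functions
  then applies.\<close>

lemma holomorphic_derivative_tendsto:
  fixes f :: "nat \<Rightarrow> complex ^ 'n \<Rightarrow> complex ^ 'm"
  assumes "open U" "p \<in> U"
    and hol: "\<And>j. holomorphic_map_on (f j) U"
    and lim: "\<And>K. compact K \<Longrightarrow> K \<subseteq> U \<Longrightarrow> uniform_limit K f g sequentially"
    and f': "\<And>j. (f j has_derivative f' j) (at p)"
    and g': "(g has_derivative g') (at p)" "Vector_Spaces.linear (*s) (*s) g'"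
  shows "(\<lambda>j. f' j v) \<longlonglongrightarrow> g' v"
proof (rule vec_tendstoI)
  fix i :: 'm
  define l where "l = (\<lambda>\<zeta>::complex. p + \<zeta> *s v)"
  have blv: "bounded_linear (\<lambda>\<zeta>::complex. \<zeta> *s v)"
    unfolding linear_conv_bounded_linear[symmetric]
    by (rule linearI) (simp_all only: vector_sadd_rdistrib scaleR_vec_conv_of_real
        scaleR_conv_of_real[where 'a = complex] vector_smult_assoc)
  have l: "(l has_derivative (\<lambda>\<zeta>. \<zeta> *s v)) (at \<zeta>)" for \<zeta>
    unfolding l_def
    using has_derivative_add[OF has_derivative_const bounded_linear.has_derivative[OF blv has_derivative_ident]]
    by simp
  have cl: "continuous_on S l" for S
    using l by (meson continuous_at_imp_continuous_on has_derivative_continuous)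
  have slice: "((\<lambda>\<zeta>. F (l \<zeta>) $ i) has_field_derivative F' v $ i) (at \<zeta>)"
    if "(F has_derivative F') (at (l \<zeta>))" "Vector_Spaces.linear (*s) (*s) F'" for F F' \<zeta>
  proof -
    interpret F': Vector_Spaces.linear "(*s)" "(*s)" F' by fact
    have "((\<lambda>\<zeta>. F (l \<zeta>) $ i) has_derivative (\<lambda>\<zeta>. F' (\<zeta> *s v) $ i)) (at \<zeta>)"
      using bounded_linear.has_derivative[OF bounded_linear_vec_nth diff_chain_at[OF l that(1)], of i]
      by (simp add: o_def)
    then show ?thesis
      by (simp add: has_field_derivative_def F'.scale mult_commute_abs)
  qed
  have f'_lin: "Vector_Spaces.linear (*s) (*s) (f' j)" for j
    using hol[of j] assms(2) f'[of j] has_derivative_unique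
    unfolding holomorphic_map_on_def by blast
  have "open (l -` U)" using cl[of UNIV] assms(1) by (simp add: open_vimage)
  moreover have "0 \<in> l -` U" by (simp add: l_def assms(2))
  ultimately obtain r where r: "r > 0" "cball 0 r \<subseteq> l -` U"
    by (meson open_contains_cball)
  have "uniform_limit (l ` cball 0 r) f g sequentially"
    using r(2) by (intro lim compact_continuous_image cl) auto
  then have u1: "uniform_limit (cball 0 r) (\<lambda>j \<zeta>. f j (l \<zeta>) $ i) (\<lambda>\<zeta>. g (l \<zeta>) $ i) sequentially"
    unfolding uniform_limit_iff
    by (elim all_forward imp_forward eventually_mono)
       (auto intro: le_less_trans[OF dist_vec_nth_le])
  have "uniform_limit (ball 0 r) (\<lambda>j \<zeta>. f j (l \<zeta>) $ i) (\<lambda>\<zeta>. g (l \<zeta>) $ i) sequentially"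
    by (rule uniform_limit_on_subset[OF u1]) auto
  moreover have "(\<lambda>\<zeta>. f j (l \<zeta>) $ i) holomorphic_on ball 0 r" for j
  proof (rule holomorphic_onI)
    fix \<zeta> :: complex assume "\<zeta> \<in> ball 0 r"
    then have "l \<zeta> \<in> U" using r(2) ball_subset_cball by blast
    then obtain F' where "(f j has_derivative F') (at (l \<zeta>))" "Vector_Spaces.linear (*s) (*s) F'"
      using hol[of j] by (auto simp: holomorphic_map_on_def)
    from slice[OF this] show "(\<lambda>\<zeta>. f j (l \<zeta>) $ i) field_differentiable at \<zeta> within ball 0 r"
      using field_differentiable_at_within field_differentiable_def by blast
  qed
  ultimately have "(\<lambda>j. deriv (\<lambda>\<zeta>. f j (l \<zeta>) $ i) 0) \<longlonglongrightarrow> deriv (\<lambda>\<zeta>. g (l \<zeta>) $ i) 0"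
    using r(1) by (intro deriv_complex_uniform_limit[where A = "ball 0 r"]) auto
  moreover have "deriv (\<lambda>\<zeta>. f j (l \<zeta>) $ i) 0 = f' j v $ i" for j
    by (rule DERIV_imp_deriv, rule slice[OF _ f'_lin]) (simp add: l_def f')
  moreover have "deriv (\<lambda>\<zeta>. g (l \<zeta>) $ i) 0 = g' v $ i"
    by (rule DERIV_imp_deriv, rule slice[OF _ g'(2)]) (simp add: l_def g')
  ultimately show "(\<lambda>j. f' j v $ i) \<longlonglongrightarrow> g' v $ i" by simp
qed

section \<open>Convergent sequences of linear maps\<close>

text \<open>In finite dimension it is enough to test convergence of linear maps on the finitely many basis
  vectors; passing to bounded linear maps turns this into convergence in operator norm.\<close>

lemma Blinfun_tendsto_pointwise:
  fixes B :: "nat \<Rightarrow> 'a::euclidean_space \<Rightarrow> 'b::real_normed_vector"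
  assumes "\<And>j. linear (B j)" "linear L" "\<And>v. (\<lambda>j. B j v) \<longlonglongrightarrow> L v"
  shows "(\<lambda>j. Blinfun (B j)) \<longlonglongrightarrow> Blinfun L"
    and "blinfun_apply (Blinfun (B j)) = B j" and "blinfun_apply (Blinfun L) = L"
proof -
  have "bounded_linear (B j)" "bounded_linear L" for j
    using assms(1,2) linear_conv_bounded_linear by blast+
  then have ap: "blinfun_apply (Blinfun (B j)) = B j" "blinfun_apply (Blinfun L) = L" for j
    by (simp_all add: bounded_linear_Blinfun_apply)
  then show "blinfun_apply (Blinfun (B j)) = B j" "blinfun_apply (Blinfun L) = L"
    by simp_all
  show "(\<lambda>j. Blinfun (B j)) \<longlonglongrightarrow> Blinfun L"
    using assms(3) by (intro tendsto_componentwise1) (simp add: ap)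
qed

lemma linear_tendsto_operator_norm:
  fixes B :: "nat \<Rightarrow> 'a::euclidean_space \<Rightarrow> 'b::real_normed_vector"
  assumes B: "\<And>j. linear (B j)" "linear L" "\<And>v. (\<lambda>j. B j v) \<longlonglongrightarrow> L v" and "e > 0"
  shows "\<forall>\<^sub>F j in sequentially. \<forall>v. norm (B j v - L v) \<le> e * norm v"
proof -
  note ap = Blinfun_tendsto_pointwise(2,3)[OF B]
  have "\<forall>\<^sub>F j in sequentially. dist (Blinfun (B j)) (Blinfun L) < e"
    using Blinfun_tendsto_pointwise(1)[OF B] \<open>e > 0\<close> tendstoD by blast
  then show ?thesis
  proof eventually_elim
    case (elim j)
    show ?case
    proof
      fix v
      have "norm (B j v - L v) \<le> norm (Blinfun (B j) - Blinfun L) * norm v"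
        using norm_blinfun[of "Blinfun (B j) - Blinfun L" v] by (simp add: blinfun.diff_left ap)
      also have "\<dots> \<le> e * norm v"
        using elim by (intro mult_right_mono) (auto simp: dist_norm)
      finally show "norm (B j v - L v) \<le> e * norm v" .
    qed
  qed
qed

lemma uniform_limit_linear_apply:
  fixes P :: "nat \<Rightarrow> 'a::euclidean_space \<Rightarrow> 'b::real_normed_vector"
  assumes P: "\<And>j. linear (P j)" "linear L" "\<And>v. (\<lambda>j. P j v) \<longlonglongrightarrow> L v"
    and w: "uniform_limit K w w0 sequentially" "bounded (w0 ` K)"
  shows "uniform_limit K (\<lambda>j z. P j (w j z)) (\<lambda>z. L (w0 z)) sequentially"
proof -
  note ap = Blinfun_tendsto_pointwise(2,3)[OF P]
  have "uniform_limit K (\<lambda>j _. Blinfun (P j)) (\<lambda>_. Blinfun L) sequentially"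
    using Blinfun_tendsto_pointwise(1)[OF P]
    by (auto simp: uniform_limit_iff tendsto_iff elim!: all_forward eventually_mono)
  from bounded_bilinear.bounded_uniform_limit[OF bounded_bilinear_blinfun_apply this w]
  show ?thesis by (auto simp: ap image_constant_conv)
qed

text \<open>The solution of a linear system depends continuously on the system: with \<open>x = w j z - M (u0 z)\<close>, the identity
  \<open>L x = (u j z - u0 z) - (B j - L) x - (B j - L) (M (u0 z))\<close> bounds \<open>norm x\<close> by small terms and a
  multiple of \<open>norm x\<close> that can be absorbed.\<close>

lemma uniform_limit_linear_solve:
  fixes B :: "nat \<Rightarrow> 'a::euclidean_space \<Rightarrow> 'b::euclidean_space"
  assumes B: "\<And>j. linear (B j)" "linear L" "\<And>v. (\<lambda>j. B j v) \<longlonglongrightarrow> L v"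
    and M: "linear M" "\<And>v. M (L v) = v" "\<And>v. L (M v) = v"
    and u: "uniform_limit K u u0 sequentially" "bounded (u0 ` K)"
    and w: "\<And>j z. z \<in> K \<Longrightarrow> B j (w j z) = u j z"
  shows "uniform_limit K w (\<lambda>z. M (u0 z)) sequentially"
proof (rule uniform_limitI)
  fix e :: real assume e: "e > 0"
  obtain c where c: "c > 0" "\<And>v. norm (M v) \<le> c * norm v"
    using linear_bounded_pos[OF M(1)] by blast
  have "bounded ((\<lambda>z. M (u0 z)) ` K)"
    using bounded_linear_image[OF u(2), of M] M(1) by (simp add: linear_conv_bounded_linear image_image)
  then obtain N where N: "N > 0" "\<And>z. z \<in> K \<Longrightarrow> norm (M (u0 z)) \<le> N"
    by (auto simp: bounded_pos)
  \<comment> \<open>The first bound lets half of \<open>norm x\<close> be absorbed, the second keeps the error at \<open>M (u0 z)\<close> small.\<close>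
  define \<eta> where "\<eta> = min (1 / (2 * c)) (e / (8 * c * N))"
  have \<eta>: "\<eta> > 0" "c * \<eta> \<le> 1/2" "c * (\<eta> * N) \<le> e/8"
  proof -
    show "\<eta> > 0" using c N e by (simp add: \<eta>_def)
    have "\<eta> \<le> 1 / (2 * c)" by (simp add: \<eta>_def)
    then show "c * \<eta> \<le> 1/2" using c by (simp add: field_simps)
    have "\<eta> \<le> e / (8 * c * N)" by (simp add: \<eta>_def)
    then show "c * (\<eta> * N) \<le> e/8" using c N by (simp add: field_simps)
  qed
  have "\<forall>\<^sub>F j in sequentially. \<forall>v. norm (B j v - L v) \<le> \<eta> * norm v"
    by (rule linear_tendsto_operator_norm[OF B \<eta>(1)])
  moreover have "\<forall>\<^sub>F j in sequentially. \<forall>z\<in>K. dist (u j z) (u0 z) < e / (8 * c)"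
    using u(1) e c by (intro uniform_limitD) auto
  ultimately show "\<forall>\<^sub>F j in sequentially. \<forall>z\<in>K. dist (w j z) (M (u0 z)) < e"
  proof eventually_elim
    case (elim j)
    show ?case
    proof
      fix z assume z: "z \<in> K"
      define x where "x = w j z - M (u0 z)"
      have "x = M (L x)" by (simp add: M)
      also have "L x = (u j z - u0 z) - (B j x - L x) - (B j (M (u0 z)) - L (M (u0 z)))"
        by (simp add: x_def linear_diff[OF B(1)] linear_diff[OF B(2)] w z M(3))
      finally have "norm x \<le> c * norm ((u j z - u0 z) - (B j x - L x) - (B j (M (u0 z)) - L (M (u0 z))))"
        using c(2) by metis
      also have "\<dots> \<le> c * (e / (8 * c) + \<eta> * norm x + \<eta> * N)"
      proof (rule mult_left_mono)
        have "norm (u j z - u0 z) \<le> e / (8 * c)" using elim(2) z by (force simp: dist_norm)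
        moreover have "norm (B j x - L x) \<le> \<eta> * norm x" using elim(1) by blast
        moreover have "norm (B j (M (u0 z)) - L (M (u0 z))) \<le> \<eta> * N"
          using elim(1) N(2)[OF z] \<eta>(1) by (meson mult_left_mono order_trans less_imp_le)
        ultimately show "norm ((u j z - u0 z) - (B j x - L x) - (B j (M (u0 z)) - L (M (u0 z))))
            \<le> e / (8 * c) + \<eta> * norm x + \<eta> * N"
          by (smt (verit) norm_triangle_ineq4)
      qed (use c in simp)
      also have "\<dots> = e / 8 + (c * \<eta>) * norm x + c * (\<eta> * N)"
        using c by (simp add: field_simps)
      also have "\<dots> \<le> e/8 + 1/2 * norm x + e/8"
        using \<eta> by (intro add_mono mult_right_mono) auto
      finally show "dist (w j z) (M (u0 z)) < e"
        using e by (simp add: dist_norm x_def)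
    qed
  qed
qed

section \<open>Locally uniform convergence of compositions and inverses\<close>

text \<open>A closed neighbourhood of the compact set \<open>g0 ` K\<close> still lies in \<open>U\<close>. It contains
  \<open>g j ` K\<close> for large \<open>j\<close>, the maps \<open>f j\<close> converge uniformly on it, and \<open>f0\<close> is uniformly continuous
  there.\<close>

lemma uniform_limit_compose_locally:
  fixes f :: "nat \<Rightarrow> 'a::heine_borel \<Rightarrow> 'b::metric_space"
  assumes "open U" "compact (g0 ` K)" "g0 ` K \<subseteq> U" "continuous_on U f0"
    and f: "\<And>C. compact C \<Longrightarrow> C \<subseteq> U \<Longrightarrow> uniform_limit C f f0 sequentially"
    and g: "uniform_limit K g g0 sequentially"
  shows "\<forall>\<^sub>F j in sequentially. g j ` K \<subseteq> U"
    and "uniform_limit K (\<lambda>j z. f j (g j z)) (\<lambda>z. f0 (g0 z)) sequentially"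
proof -
  obtain d C where d: "d > 0" and C: "compact C" "C \<subseteq> U" "g0 ` K \<subseteq> C"
    and dC: "\<And>x z. z \<in> K \<Longrightarrow> dist x (g0 z) < d \<Longrightarrow> x \<in> C"
  proof (cases "K = {}")
    case True
    then show ?thesis using that[of 1 "{}"] by auto
  next
    case False
    then have ne: "g0 ` K \<noteq> {}" by auto
    obtain d where d: "d > 0" "{x. infdist x (g0 ` K) \<le> d} \<subseteq> U"
      using compact_in_open_separated[OF ne assms(2,1,3)] by blast
    have 1: "compact {x. infdist x (g0 ` K) \<le> d}"
      by (rule compact_infdist_le[OF ne assms(2) d(1)])
    have 2: "x \<in> {x. infdist x (g0 ` K) \<le> d}" if "z \<in> K" "dist x (g0 z) < d" for x z
      using that infdist_le[of "g0 z" "g0 ` K" x] by auto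
    show ?thesis
      by (rule that[OF d(1) 1 d(2) _ 2]) (use d(1) in \<open>auto simp: infdist_zero\<close>)
  qed
  have near: "\<forall>\<^sub>F j in sequentially. \<forall>z\<in>K. dist (g j z) (g0 z) < d" if "d > 0" for d
    using g that by (rule uniform_limitD)
  show "\<forall>\<^sub>F j in sequentially. g j ` K \<subseteq> U"
    using near[OF d] by eventually_elim (use dC C(2) in blast)
  show "uniform_limit K (\<lambda>j z. f j (g j z)) (\<lambda>z. f0 (g0 z)) sequentially"
  proof (rule uniform_limitI)
    fix e :: real assume e: "e > 0"
    have "uniformly_continuous_on C f0"
      using C assms(4) by (meson compact_uniformly_continuous continuous_on_subset)
    then obtain d' where d': "d' > 0" "\<And>x y. x \<in> C \<Longrightarrow> y \<in> C \<Longrightarrow> dist x y < d' \<Longrightarrow> dist (f0 x) (f0 y) < e/2"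
      using e unfolding uniformly_continuous_on_def by (metis half_gt_zero dist_commute)
    have "\<forall>\<^sub>F j in sequentially. \<forall>x\<in>C. dist (f j x) (f0 x) < e/2"
      using f[OF C(1,2)] e by (intro uniform_limitD) auto
    with near[OF d] near[OF d'(1)]
    show "\<forall>\<^sub>F j in sequentially. \<forall>z\<in>K. dist (f j (g j z)) (f0 (g0 z)) < e"
    proof eventually_elim
      case (elim j)
      show ?case
      proof
        fix z assume z: "z \<in> K"
        have gz: "g j z \<in> C" "g0 z \<in> C" using elim(1) dC z C(3) by blast+
        have "dist (f j (g j z)) (f0 (g j z)) < e/2" using elim(3) gz by blast
        moreover have "dist (f0 (g j z)) (f0 (g0 z)) < e/2" using d'(2) gz elim(2) z by blast
        ultimately show "dist (f j (g j z)) (f0 (g0 z)) < e"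
          by (metis dist_triangle_half_l dist_commute)
      qed
    qed
  qed
qed

text \<open>To solve \<open>f j z = w\<close> near \<open>g' w\<close>, rewrite the equation as \<open>z = g' (g z - f j z + w)\<close>. When
  \<open>f j\<close> is close to \<open>g\<close> near \<open>g' w\<close>, the right-hand side is close to \<open>g' w\<close> and so maps a small ball
  around \<open>g' w\<close> into itself; Brouwer's theorem provides a solution in that ball, and injectivity
  identifies it with \<open>inv (f j) w\<close>. Estimates on the inverses \<open>inv (f j)\<close> are thereby avoided.\<close>

lemma uniform_limit_inverse_homeomorphisms:
  fixes f :: "nat \<Rightarrow> 'a::euclidean_space \<Rightarrow> 'a"
  assumes cont: "\<And>j. continuous_on UNIV (f j)" and inj: "\<And>j. inj (f j)"
    and g: "continuous_on UNIV g" "continuous_on UNIV g'" "\<And>x. g' (g x) = x" "\<And>y. g (g' y) = y"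
    and lim: "\<And>C. compact C \<Longrightarrow> uniform_limit C f g sequentially"
    and K: "compact K"
  shows "uniform_limit K (\<lambda>j. inv (f j)) g' sequentially"
proof (rule uniform_limitI)
  fix e' :: real assume e': "e' > 0"
  define e where "e = e' / 2"
  have e: "e > 0" "e < e'" using e' by (auto simp: e_def)
  \<comment> \<open>Uniform continuity of \<open>g'\<close> is used at points of \<open>K\<close> and at points within distance 1 of them.\<close>
  define N where "N = {x + y | x y. x \<in> K \<and> y \<in> cball (0 :: 'a) 1}"
  have cN: "compact N"
    unfolding N_def by (rule compact_sums[OF K compact_cball])
  have "uniformly_continuous_on (N) g'"
    using g(2) cN by (meson compact_uniformly_continuous continuous_on_subset subset_UNIV)
  then obtain d where d: "d > 0"
    "\<And>x y. x \<in> N \<Longrightarrow> y \<in> N \<Longrightarrow> dist x y < d \<Longrightarrow> dist (g' x) (g' y) < e"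
    using e unfolding uniformly_continuous_on_def by (metis dist_commute)
  define C where "C = {x + y | x y. x \<in> g' ` K \<and> y \<in> cball 0 e}"
  have "compact (g' ` K)"
    using g(2) K by (meson compact_continuous_image continuous_on_subset subset_UNIV)
  then have "compact C"
    unfolding C_def by (rule compact_sums[OF _ compact_cball])
  then have "\<forall>\<^sub>F j in sequentially. \<forall>z\<in>C. dist (f j z) (g z) < min d 1"
    using lim d(1) by (intro uniform_limitD) auto
  then show "\<forall>\<^sub>F j in sequentially. \<forall>w\<in>K. dist (inv (f j) w) (g' w) < e'"
  proof eventually_elim
    case (elim j)
    show ?case
    proof
      fix w assume w: "w \<in> K"
      define F where "F = (\<lambda>z. g' (g z - f j z + w))"
      have "F z \<in> cball (g' w) e" if z: "z \<in> cball (g' w) e" for z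
      proof -
        have "z = g' w + (z - g' w)" "z - g' w \<in> cball 0 e"
          using z by (auto simp: dist_norm norm_minus_commute)
        then have "z \<in> C" using w unfolding C_def by blast
        then have s: "norm (g z - f j z) < min d 1"
          using elim by (simp add: dist_norm norm_minus_commute)
        have "g z - f j z + w = w + (g z - f j z)" "w = w + 0" by auto
        then have "g z - f j z + w \<in> N" "w \<in> N"
          using w s unfolding N_def by (smt (verit) mem_Collect_eq mem_cball_0 norm_zero)+
        then have "dist (F z) (g' w) < e"
          unfolding F_def using s by (intro d(2)) (auto simp: dist_norm)
        then show ?thesis by (simp add: dist_commute)
      qed
      moreover have "continuous_on (cball (g' w) e) F"
        unfolding F_def
        by (intro continuous_on_compose2[OF g(2)] continuous_intros
             continuous_on_subset[OF g(1)] continuous_on_subset[OF cont]) auto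
      ultimately obtain z where z: "z \<in> cball (g' w) e" "F z = z"
        using brouwer[of "cball (g' w) e" F] e by auto
      from z(2) have "g z = g z - f j z + w" unfolding F_def by (metis g(4))
      then have "f j z = w" by simp
      then have "inv (f j) w = z" using inj by (metis inv_f_f)
      then show "dist (inv (f j) w) (g' w) < e'" using z(1) e by (simp add: dist_commute)
    qed
  qed
qed



section \<open>The scaling sequence\<close>

theorem theorem3p6:
  fixes \<Omega> :: "(complex ^ 'n) set"
    and p :: "complex ^ 'n"
    and \<phi> \<psi> D :: "nat \<Rightarrow> complex ^ 'n \<Rightarrow> complex ^ 'n"
    and \<psi>hat :: "complex ^ 'n \<Rightarrow> complex ^ 'n"
  assumes "open \<Omega>" and "connected \<Omega>" and "bounded \<Omega>"
    and "p \<in> \<Omega>"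
    and "\<And>j. \<phi> j \<in> Aut \<Omega>"
    and "\<exists>q\<in>frontier \<Omega>. (\<lambda>j. \<phi> j p) \<longlonglongrightarrow> q"
    and "\<And>j. \<psi> j \<in> Aut UNIV"
    and "\<psi>hat \<in> Aut UNIV"
    and "compact_convergence (\<lambda>_. UNIV) \<psi> UNIV \<psi>hat"
    and "\<And>j. complex_affine (D j)"
    and "\<exists>h. biholomorphism_into h \<Omega> \<and>
           compact_convergence (\<lambda>_. \<Omega>) (\<lambda>j. D j \<circ> \<psi> j \<circ> \<phi> j) \<Omega> h"
  shows "\<exists>r \<omega>. strict_mono (r :: nat \<Rightarrow> nat) \<and> biholomorphism_into \<omega> (\<psi>hat ` \<Omega>) \<and>
           compact_convergence (\<lambda>j. \<psi> (r j) ` \<Omega>)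
             (\<lambda>j. frankel_scaling (\<psi> (r j)) (\<phi> (r j)) p) (\<psi>hat ` \<Omega>) \<omega>"
proof -
  obtain h where h: "biholomorphism_into h \<Omega>"
    and h_lim: "compact_convergence (\<lambda>_. \<Omega>) (\<lambda>j. D j \<circ> \<psi> j \<circ> \<phi> j) \<Omega> h"
    using assms(11) by blast
  define hj where "hj = (\<lambda>j. D j \<circ> \<psi> j \<circ> \<phi> j)"
  define \<iota> where "\<iota> = (\<lambda>j. inv (\<psi> j))"
  define \<iota>hat where "\<iota>hat = inv \<psi>hat"
  have bih: "biholomorphism (\<psi> j) UNIV UNIV" "biholomorphism (\<phi> j) \<Omega> \<Omega>"
    "biholomorphism \<psi>hat UNIV UNIV" for j
    using assms(5,7,8) by (simp_all add: Aut_def)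
  have bih_\<iota>: "biholomorphism (\<iota> j) UNIV UNIV" "biholomorphism \<iota>hat UNIV UNIV" for j
    unfolding \<iota>_def \<iota>hat_def using bih by (auto intro: biholomorphism_inv_into)
  have bij: "bij (\<psi> j)" "bij \<psi>hat" for j
    using bih by (auto simp: biholomorphism_def)
  have \<iota>_id: "\<iota> j (\<psi> j z) = z" "\<psi> j (\<iota> j z) = z" "\<iota>hat (\<psi>hat z) = z" "\<psi>hat (\<iota>hat z) = z" for j z
    using bij by (simp_all add: \<iota>_def \<iota>hat_def bij_is_inj bij_is_surj surj_f_inv_f)
  have hol: "holomorphic_map_on (\<psi> j) UNIV" "holomorphic_map_on (\<phi> j) \<Omega>" for j
    using bih by (auto simp: biholomorphism_def)
  have cont: "continuous_on UNIV (\<psi> j)" "continuous_on UNIV \<psi>hat" "continuous_on UNIV \<iota>hat" for j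
    using bih bih_\<iota> by (auto simp: biholomorphism_def intro: holomorphic_map_on_imp_continuous_on)
  have cont_h: "continuous_on \<Omega> h"
    using h by (auto simp: biholomorphism_into_def biholomorphism_def intro: holomorphic_map_on_imp_continuous_on)

  have "\<forall>j. \<exists>A b. \<forall>z. D j z = A *v z + b"
    using assms(10) by (simp add: complex_affine_def)
  then obtain A b where D: "\<And>j z. D j z = A j *v z + b j" by metis
  have A_lin: "Vector_Spaces.linear (*s) (*s) ((*v) (A j))" for j
    by (rule matrix_vector_mul_linear_gen)
  have D_deriv: "(D j has_derivative (*v) (A j)) (at z)" for j z
  proof -
    have "bounded_linear ((*v) (A j))"
      using complex_linear_imp_linear[OF A_lin] by (simp add: linear_conv_bounded_linear)
    then have "((\<lambda>z. A j *v z + b j) has_derivative (\<lambda>v. A j *v v + 0)) (at z)"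
      by (intro has_derivative_add bounded_linear_imp_has_derivative has_derivative_const)
    moreover have "D j = (\<lambda>z. A j *v z + b j)" by (simp add: D fun_eq_iff)
    ultimately show ?thesis by simp
  qed
  have hol_D: "holomorphic_map_on (D j) UNIV" for j
    using D_deriv A_lin by (auto simp: holomorphic_map_on_def)
  have hol_hj: "holomorphic_map_on (hj j) \<Omega>" for j
    unfolding hj_def
    by (rule holomorphic_map_on_compose[OF hol(2) holomorphic_map_on_compose[OF hol(1) hol_D] subset_UNIV,
          folded comp_assoc]) simp

  have \<psi>_lim: "uniform_limit C \<psi> \<psi>hat sequentially" if "compact C" for C
    using assms(9) that by (simp add: compact_convergence_def)
  have hj_lim: "uniform_limit C hj h sequentially" if "compact C" "C \<subseteq> \<Omega>" for C
    using h_lim that by (simp add: compact_convergence_def hj_def)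

  have "\<exists>P Q. (\<psi> j has_derivative P) (at p) \<and> Vector_Spaces.linear (*s) (*s) P \<and> (\<forall>v. Q (P v) = v) \<and> (\<forall>v. P (Q v) = v)" for j
    using biholomorphism_derivative[OF bih(1) UNIV_I] by metis
  then obtain P Q where P: "\<And>j. (\<psi> j has_derivative P j) (at p)"
    "\<And>j. Vector_Spaces.linear (*s) (*s) (P j)" "\<And>j v. Q j (P j v) = v" "\<And>j v. P j (Q j v) = v"
    by metis
  obtain Phat Qhat where Phat: "(\<psi>hat has_derivative Phat) (at p)"
    "Vector_Spaces.linear (*s) (*s) Phat" "Vector_Spaces.linear (*s) (*s) Qhat"
    "\<And>v. Qhat (Phat v) = v" "\<And>v. Phat (Qhat v) = v"
    using biholomorphism_derivative[OF bih(3) UNIV_I] by metis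
  obtain H M where H: "(h has_derivative H) (at p)"
    "Vector_Spaces.linear (*s) (*s) H" "Vector_Spaces.linear (*s) (*s) M"
    "\<And>v. M (H v) = v" "\<And>v. H (M v) = v"
    using biholomorphism_derivative[OF h[unfolded biholomorphism_into_def] assms(4)] by metis

  define G where "G = (\<lambda>j. \<psi> j \<circ> \<phi> j \<circ> \<iota> j)"
  have bih_G: "biholomorphism (G j) (\<psi> j ` \<Omega>) (\<psi> j ` \<Omega>)" for j
  proof -
    have 1: "biholomorphism (\<psi> j) \<Omega> (\<psi> j ` \<Omega>)"
      by (rule biholomorphism_restrict[OF bih(1) assms(1) subset_UNIV])
    then have "open (\<psi> j ` \<Omega>)" by (simp add: biholomorphism_def)
    then have "biholomorphism (\<iota> j) (\<psi> j ` \<Omega>) (\<iota> j ` \<psi> j ` \<Omega>)"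
      by (rule biholomorphism_restrict[OF bih_\<iota>(1) _ subset_UNIV])
    then have 2: "biholomorphism (\<iota> j) (\<psi> j ` \<Omega>) \<Omega>" by (simp add: image_image \<iota>_id)
    show ?thesis
      unfolding G_def comp_assoc
      by (rule biholomorphism_compose[OF biholomorphism_compose[OF 2 bih(2)] 1])
  qed
  \<comment> \<open>\<open>frankel_scaling\<close> inverts \<open>L j\<close> by \<open>inv\<close>, which is a right inverse as \<open>L j\<close> is onto.\<close>
  have "\<exists>L L'. (G j has_derivative L) (at (\<psi> j p)) \<and> Vector_Spaces.linear (*s) (*s) L \<and> (\<forall>v. L (L' v) = v)" for j
    using biholomorphism_derivative[OF bih_G imageI[OF assms(4)]] by metis
  then obtain L L' where L: "\<And>j. (G j has_derivative L j) (at (\<psi> j p))"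
    "\<And>j. Vector_Spaces.linear (*s) (*s) (L j)" "\<And>j v. L j (L' j v) = v"
    by metis
  define S where "S = (\<lambda>j. frankel_scaling (\<psi> j) (\<phi> j) p)"
  have S: "L j (S j z) = G j z - (\<psi> j \<circ> \<phi> j) p" for j z
  proof -
    have "frechet_derivative (G j) (at (\<psi> j p)) = L j"
      using frechet_derivative_at[OF L(1)] by simp
    then have "S j z = inv (L j) (G j z - (\<psi> j \<circ> \<phi> j) p)"
      by (simp add: S_def frankel_scaling_def G_def \<iota>_def)
    moreover have "surj (L j)" using L(3) by (metis surjI)
    ultimately show ?thesis by (simp add: surj_f_inv_f)
  qed
  \<comment> \<open>The derivative of \<open>hj j\<close> at \<open>p\<close>, factored through \<open>L j\<close> by writing \<open>hj j = D j \<circ> G j \<circ> \<psi> j\<close>.\<close>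
  define B where "B = (\<lambda>j v. A j *v (L j (P j v)))"
  have B_deriv: "(hj j has_derivative B j) (at p)" for j
  proof -
    have "(D j \<circ> G j \<circ> \<psi> j has_derivative (*v) (A j) \<circ> L j \<circ> P j) (at p)"
      by (intro diff_chain_at P(1) L(1) D_deriv)
    moreover have "D j \<circ> G j \<circ> \<psi> j = hj j" by (auto simp: G_def hj_def \<iota>_id)
    moreover have "(*v) (A j) \<circ> L j \<circ> P j = B j" by (auto simp: B_def)
    ultimately show ?thesis by simp
  qed
  have B_lin: "linear (B j)" for j
    using has_derivative_linear[OF B_deriv] .
  have B_lim: "(\<lambda>j. B j v) \<longlonglongrightarrow> H v" for v
    by (rule holomorphic_derivative_tendsto[OF assms(1,4) hol_hj hj_lim B_deriv H(1,2)])
  have P_lim: "(\<lambda>j. P j v) \<longlonglongrightarrow> Phat v" for v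
    by (rule holomorphic_derivative_tendsto[OF open_UNIV UNIV_I hol(1) \<psi>_lim P(1) Phat(1,2)])
  \<comment> \<open>The linear system for \<open>Q j (S j z)\<close> in which \<open>\<phi> j\<close> and \<open>D j\<close> occur only through \<open>hj j\<close>.\<close>
  have B_S: "B j (Q j (S j z)) = hj j (\<iota> j z) - hj j p" for j z
    by (simp add: B_def P(4) S matrix_vector_mult_diff_distrib G_def hj_def D)

  define \<omega> where "\<omega> = (\<lambda>z. Phat (M (h (\<iota>hat z) - h p)))"
  have "biholomorphism_into \<omega> (\<psi>hat ` \<Omega>)"
  proof -
    have 1: "biholomorphism \<psi>hat \<Omega> (\<psi>hat ` \<Omega>)"
      by (rule biholomorphism_restrict[OF bih(3) assms(1) subset_UNIV])
    then have o: "open (\<psi>hat ` \<Omega>)" by (simp add: biholomorphism_def)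
    then have "biholomorphism \<iota>hat (\<psi>hat ` \<Omega>) (\<iota>hat ` \<psi>hat ` \<Omega>)"
      by (rule biholomorphism_restrict[OF bih_\<iota>(2) _ subset_UNIV])
    then have 2: "biholomorphism \<iota>hat (\<psi>hat ` \<Omega>) \<Omega>" by (simp add: image_image \<iota>_id)
    have 3: "biholomorphism (\<lambda>z. (Phat \<circ> M) (z - h p)) UNIV UNIV"
    proof (rule biholomorphism_complex_affine[where S = "H \<circ> Qhat"])
      show "Vector_Spaces.linear (*s) (*s) (Phat \<circ> M)"
        by (rule Vector_Spaces.linear_compose[OF H(3) Phat(2)])
      show "Vector_Spaces.linear (*s) (*s) (H \<circ> Qhat)"
        by (rule Vector_Spaces.linear_compose[OF Phat(3) H(2)])
    qed (simp_all add: Phat H)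
    have oh: "open (h ` \<Omega>)" using h by (simp add: biholomorphism_into_def biholomorphism_def)
    have "biholomorphism ((\<lambda>z. (Phat \<circ> M) (z - h p)) \<circ> (h \<circ> \<iota>hat)) (\<psi>hat ` \<Omega>)
            ((\<lambda>z. (Phat \<circ> M) (z - h p)) ` h ` \<Omega>)"
      by (rule biholomorphism_compose[OF biholomorphism_compose[OF 2 h[unfolded biholomorphism_into_def]]
            biholomorphism_restrict[OF 3 oh subset_UNIV]])
    moreover have "(\<lambda>z. (Phat \<circ> M) (z - h p)) ` h ` \<Omega> = \<omega> ` \<psi>hat ` \<Omega>"
      by (simp add: \<omega>_def image_image \<iota>_id)
    moreover have "(\<lambda>z. (Phat \<circ> M) (z - h p)) \<circ> (h \<circ> \<iota>hat) = \<omega>"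
      by (simp add: \<omega>_def fun_eq_iff)
    ultimately show ?thesis by (simp add: biholomorphism_into_def)
  qed
  moreover have "compact_convergence (\<lambda>j. \<psi> j ` \<Omega>) S (\<psi>hat ` \<Omega>) \<omega>"
    unfolding compact_convergence_def
  proof (intro allI impI, elim conjE)
    fix K assume K: "compact K" "K \<subseteq> \<psi>hat ` \<Omega>"
    have \<iota>_lim: "uniform_limit K \<iota> \<iota>hat sequentially"
      unfolding \<iota>_def
      by (rule uniform_limit_inverse_homeomorphisms[OF cont(1) bij_is_inj[OF bij(1)] cont(2,3) \<iota>_id(3,4) \<psi>_lim K(1)])
    have cK: "compact (\<iota>hat ` K)"
      by (rule compact_continuous_image[OF continuous_on_subset[OF cont(3) subset_UNIV] K(1)])
    have \<iota>K: "\<iota>hat ` K \<subseteq> \<Omega>" using K(2) by (auto simp: \<iota>_id)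
    have comp: "\<forall>\<^sub>F j in sequentially. \<iota> j ` K \<subseteq> \<Omega>"
      "uniform_limit K (\<lambda>j z. hj j (\<iota> j z)) (\<lambda>z. h (\<iota>hat z)) sequentially"
      by (rule uniform_limit_compose_locally[OF assms(1) cK \<iota>K cont_h hj_lim \<iota>_lim]; assumption)+
    from comp(1) have "\<forall>\<^sub>F j in sequentially. K \<subseteq> \<psi> j ` \<Omega>"
    proof eventually_elim
      case (elim j)
      show ?case
      proof
        fix z assume "z \<in> K"
        then have "\<iota> j z \<in> \<Omega>" using elim by blast
        then show "z \<in> \<psi> j ` \<Omega>" by (metis \<iota>_id(2) imageI)
      qed
    qed
    moreover have "uniform_limit K S \<omega> sequentially"
    proof -
      have "(\<lambda>j. hj j p) \<longlonglongrightarrow> h p"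
        by (rule tendsto_uniform_limitI[OF hj_lim[of "{p}"]]) (use assms(4) in auto)
      then have "uniform_limit K (\<lambda>j _. hj j p) (\<lambda>_. h p) sequentially"
        by (auto simp: uniform_limit_iff tendsto_iff elim!: all_forward eventually_mono)
      with comp(2) have u: "uniform_limit K (\<lambda>j z. hj j (\<iota> j z) - hj j p) (\<lambda>z. h (\<iota>hat z) - h p) sequentially"
        by (rule uniform_limit_minus)
      have "continuous_on K (\<lambda>z. h (\<iota>hat z) - h p)"
        by (intro continuous_intros continuous_on_compose2[OF cont_h continuous_on_subset[OF cont(3) subset_UNIV] \<iota>K])
      then have bu: "bounded ((\<lambda>z. h (\<iota>hat z) - h p) ` K)"
        using K(1) compact_continuous_image compact_imp_bounded by blast
      note lin = complex_linear_imp_linear[OF H(2)] complex_linear_imp_linear[OF H(3)]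
        complex_linear_imp_linear[OF P(2)] complex_linear_imp_linear[OF Phat(2)]
      have w: "uniform_limit K (\<lambda>j z. Q j (S j z)) (\<lambda>z. M (h (\<iota>hat z) - h p)) sequentially"
        by (rule uniform_limit_linear_solve[OF B_lin lin(1) B_lim lin(2) H(4,5) u bu B_S])
      have "bounded ((\<lambda>z. M (h (\<iota>hat z) - h p)) ` K)"
        using bounded_linear_image[OF bu, of M] lin(2) by (simp add: linear_conv_bounded_linear image_image)
      from uniform_limit_linear_apply[OF lin(3,4) P_lim w this]
      show ?thesis by (simp add: P(4) \<omega>_def)
    qed
    ultimately show "(\<forall>\<^sub>F j in sequentially. K \<subseteq> \<psi> j ` \<Omega>) \<and> uniform_limit K S \<omega> sequentially"
      by blast
  qed
  ultimately show ?thesis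
    by (intro exI[of _ id] exI[of _ \<omega>]) (simp add: S_def strict_mono_id)
qed

end
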